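(* Let $n\ge 0$, let $\boldsymbol{m}^n$ and $r^n$ be the magnetization and scalar auxiliary variable at time step $n$, and let $(\boldsymbol{m}^{*}, r^{*})$ be the intermediate values obtained from $(\boldsymbol{m}^n, r^n)$ by one step, with time step size $\Delta t>0$, of either the SAV1 scheme or the SAV2 scheme (both described in the context). If the two conditions $$\big(\Delta_h (\boldsymbol{m}^{*} - \boldsymbol{m}^{n}),\, \boldsymbol{m}^{*} - \boldsymbol{m}^{n}\big)_h \leq 0$$ and $$(\Delta_h \boldsymbol{m}^n, \boldsymbol{m}^{*})_h - (\Delta_h \boldsymbol{m}^{*}, \boldsymbol{m}^n)_h = 0$$ are satisfied, then the energy dissipation inequality $$\tilde{g}_h(\boldsymbol{m}^{*}, r^{*}) \leq \tilde{g}_h(\boldsymbol{m}^{n}, r^n)$$ holds, where $\tilde{g}_h$ is the discrete modified energy defined in the context.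
   Context: **Setting.** $\Omega\subset\mathbb{R}^3$ is the region of a magnetic structure. The external magnetic field is zero. Magnetizations are spatially discretized: they are elements $\boldsymbol{u}=(u_1,u_2,u_3)$ of a finite-dimensional real vector space of discrete (e.g. grid) functions on $\Omega$ with values in $\mathbb{R}^3$. The particular spatial discretization is not fixed. - $(\cdot,\cdot)_h$ is the discrete $L^2$ inner product, for scalar discrete functions and, for vector-valued ones, $(\boldsymbol{u},\boldsymbol{v})_h=\sum_{i=1}^3 (u_i,v_i)_h$. The norm is $\|\boldsymbol{u}\|_h=\sqrt{(\boldsymbol{u},\boldsymbol{u})_h}$ (similarly for scalar functions). - $\Delta_h$ is the discrete Laplace operator, a linear operator on discrete functions (approximating the Laplacian with homogeneous Neumann boundary condition). No property of $\Delta_h$ beyond linearity is assumed other than what is stated as a hypothesis in the claim. - $\boldsymbol{e}_2=(0,1,0)$, $\boldsymbol{e}_3=(0,0,1)$, and $m_i$ denotes the $i$-th component of $\boldsymbol{m}$. - $C_e=\frac{2C_{ex}}{\mu_0M_s^2}>0$ and $C_{an}=\frac{2K_u}{\mu_0M_s^2}>0$ are physical constants, where $C_{ex}$ is the exchange constant, $\mu_0$ the vacuum permeability, $M_s$ the saturation magnetization, and $K_u$ the uniaxial anisotropy constant. - $\boldsymbol{h}_m^n$ is the (discretized) magnetostatic field at time $t_n=n\Delta t$ generated by $\boldsymbol{m}^n$, i.e. a discrete function approximating $\boldsymbol{h}_m=-\frac{1}{4\pi}\nabla_{\boldsymbol{x}}\int_\Omega\nabla_{\boldsymbol{y}}\big(\frac{1}{|\boldsymbol{x}-\boldsymbol{y}|}\big)\cdot\boldsymbol{m}(\boldsymbol{y})\,\mathrm{d}\boldsymbol{y}$.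 It is assumed that $-\frac12(\boldsymbol{h}_m^n,\boldsymbol{m}^n)_h>0$, so that the schemes below are well defined. - $r^n\in\mathbb{R}$ is the current value of the scalar auxiliary variable, which approximates the square root of the magnetostatic energy. **SAV1 scheme.** Given $(\boldsymbol{m}^n,r^n)$, find $(\boldsymbol{m}^{*},r^{*})$ and then $(\boldsymbol{m}^{n+1},r^{n+1})$ such that $$\frac{\boldsymbol{m}^{*}-\boldsymbol{m}^n}{\Delta t}=C_e\Delta_h\boldsymbol{m}^{*}-C_{an}(m_2^{*}\boldsymbol{e}_2+m_3^{*}\boldsymbol{e}_3)+\frac{r^{*}}{\sqrt{-\frac12(\boldsymbol{h}_m^n,\boldsymbol{m}^n)_h}}\,\boldsymbol{h}_m^n,$$ $$\frac{r^{*}-r^n}{\Delta t}=-\frac{1}{2\sqrt{-\frac12(\boldsymbol{h}_m^n,\boldsymbol{m}^n)_h}}\Big(\boldsymbol{h}_m^n,\frac{\boldsymbol{m}^{*}-\boldsymbol{m}^n}{\Delta t}\Big)_h,$$ $$\boldsymbol{m}^{n+1}=\frac{\boldsymbol{m}^{*}}{|\boldsymbol{m}^{*}|}\ \text{(pointwise)},$$ $$\frac{r^{n+1}-r^n}{\Delta t}=-\frac{1}{2\sqrt{-\frac12(\boldsymbol{h}_m^n,\boldsymbol{m}^n)_h}}\Big(\boldsymbol{h}_m^n,\frac{\boldsymbol{m}^{n+1}-\boldsymbol{m}^n}{\Delta t}\Big)_h.$$ **SAV2 scheme.** The same first three equations (for $\boldsymbol{m}^{*}$, $r^{*}$, $\boldsymbol{m}^{n+1}$),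 but the last equation is replaced by $$r^{n+1}=\sqrt{-\tfrac12(\boldsymbol{h}_m^{n+1},\boldsymbol{m}^{n+1})_h}.$$ In both schemes the pair $(\boldsymbol{m}^{*},r^{*})$ is thus determined from $(\boldsymbol{m}^n,r^n)$ by the first two equations. **Discrete modified energy.** For a discrete magnetization $\boldsymbol{m}$ and $r\in\mathbb{R}$, $$\tilde g_h(\boldsymbol{m},r)=-\frac{C_e}{2}(\Delta_h\boldsymbol{m},\boldsymbol{m})_h+\frac{C_{an}}{2}\big(\|m_2\|_h^2+\|m_3\|_h^2\big)+r^2.$$ *)

theory Defs
  imports "HOL-Analysis.Analysis"
begin

text \<open>
  The spatial discretization is left open. The scalar discrete functions form an arbitrary
  finite-dimensional real inner product space, given as a type \<open>'f :: euclidean_space\<close> whose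
  inner product is \<open>(u, v)\<^sub>h\<close>. A vector-valued discrete function is \<open>u :: 'f ^ 3\<close> with
  components \<open>u $ 1, u $ 2, u $ 3\<close>. The library inner product on \<open>'f ^ 3\<close> is the sum of the
  componentwise inner products, i.e. \<open>(u, v)\<^sub>h\<close> for vector-valued functions, and \<open>norm\<close> is the
  induced norm in both cases.

  Elements of \<open>'f\<close> are realised as functions on \<open>\<Omega>\<close> by the evaluation map \<open>ev\<close>. The set \<open>N\<close>
  consists of the nodes at which pointwise identities between discrete functions are imposed
  (grid points, element nodes, ...); a discrete function is determined by its nodal values.
\<close>

locale discrete_functions =
  fixes \<Omega> N :: "(real ^ 3) set"
    and ev :: "'f :: euclidean_space \<Rightarrow> real ^ 3 \<Rightarrow> real"
  assumes nodes_subset: "N \<subseteq> \<Omega>"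
    and linear_ev: "\<And>x. x \<in> \<Omega> \<Longrightarrow> linear (\<lambda>f. ev f x)"
    and nodal_values: "\<And>f g. (\<And>x. x \<in> N \<Longrightarrow> ev f x = ev g x) \<Longrightarrow> f = g"

definition point_value ::
    "('f :: euclidean_space \<Rightarrow> real ^ 3 \<Rightarrow> real) \<Rightarrow> 'f ^ 3 \<Rightarrow> real ^ 3 \<Rightarrow> real ^ 3" where
  "point_value ev u x = (\<chi> i. ev (u $ i) x)"

text \<open>
  The equations determining \<open>(m\<^sup>*, r\<^sup>*)\<close> from \<open>(m\<^sup>n, r\<^sup>n)\<close>, where \<open>h\<close> is the magnetostatic field
  of \<open>m\<^sup>n\<close>. For \<open>f :: 'f\<close>, the term \<open>axis i f :: 'f ^ 3\<close> is the vector-valued function \<open>f e\<^sub>i\<close>.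
\<close>

definition sav_intermediate ::
    "('f :: euclidean_space ^ 3 \<Rightarrow> 'f ^ 3) \<Rightarrow> real \<Rightarrow> real \<Rightarrow> real \<Rightarrow> 'f ^ 3
      \<Rightarrow> 'f ^ 3 \<Rightarrow> real \<Rightarrow> 'f ^ 3 \<Rightarrow> real \<Rightarrow> bool" where
  "sav_intermediate \<Delta>\<^sub>h C\<^sub>e C\<^sub>a\<^sub>n \<Delta>t h m\<^sub>n r\<^sub>n m\<^sub>s r\<^sub>s \<longleftrightarrow>
     (m\<^sub>s - m\<^sub>n) /\<^sub>R \<Delta>t =
       C\<^sub>e *\<^sub>R \<Delta>\<^sub>h m\<^sub>s - C\<^sub>a\<^sub>n *\<^sub>R (axis 2 (m\<^sub>s $ 2) + axis 3 (m\<^sub>s $ 3))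
         + (r\<^sub>s / sqrt (- (1/2) * (h \<bullet> m\<^sub>n))) *\<^sub>R h \<and>
     (r\<^sub>s - r\<^sub>n) / \<Delta>t =
       - (1 / (2 * sqrt (- (1/2) * (h \<bullet> m\<^sub>n)))) * (h \<bullet> ((m\<^sub>s - m\<^sub>n) /\<^sub>R \<Delta>t))"

text \<open>
  \<open>m' = m\<^sup>* / |m\<^sup>*|\<close> pointwise. At a node where \<open>m\<^sup>*\<close> vanishes, the convention
  \<open>inverse 0 = 0\<close> gives \<open>m' = 0\<close>.
\<close>

definition is_normalization ::
    "(real ^ 3) set \<Rightarrow> ('f :: euclidean_space \<Rightarrow> real ^ 3 \<Rightarrow> real) \<Rightarrow> 'f ^ 3 \<Rightarrow> 'f ^ 3 \<Rightarrow> bool" where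
  "is_normalization N ev m\<^sub>s m' \<longleftrightarrow>
     (\<forall>x\<in>N. point_value ev m' x = point_value ev m\<^sub>s x /\<^sub>R norm (point_value ev m\<^sub>s x))"

text \<open>
  One step \<open>(m\<^sup>n, r\<^sup>n) \<mapsto> (m\<^sup>*, r\<^sup>*) \<mapsto> (m\<^sup>n\<^sup>+\<^sup>1, r\<^sup>n\<^sup>+\<^sup>1)\<close> of the two schemes. The argument \<open>H\<close> maps a
  discrete magnetization to its discretized magnetostatic field.
\<close>

definition sav1_step ::
    "(real ^ 3) set \<Rightarrow> ('f :: euclidean_space \<Rightarrow> real ^ 3 \<Rightarrow> real) \<Rightarrow> ('f ^ 3 \<Rightarrow> 'f ^ 3)
      \<Rightarrow> ('f ^ 3 \<Rightarrow> 'f ^ 3) \<Rightarrow> real \<Rightarrow> real \<Rightarrow> real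
      \<Rightarrow> 'f ^ 3 \<Rightarrow> real \<Rightarrow> 'f ^ 3 \<Rightarrow> real \<Rightarrow> 'f ^ 3 \<Rightarrow> real \<Rightarrow> bool" where
  "sav1_step N ev \<Delta>\<^sub>h H C\<^sub>e C\<^sub>a\<^sub>n \<Delta>t m\<^sub>n r\<^sub>n m\<^sub>s r\<^sub>s m' r' \<longleftrightarrow>
     sav_intermediate \<Delta>\<^sub>h C\<^sub>e C\<^sub>a\<^sub>n \<Delta>t (H m\<^sub>n) m\<^sub>n r\<^sub>n m\<^sub>s r\<^sub>s \<and>
     is_normalization N ev m\<^sub>s m' \<and>
     (r' - r\<^sub>n) / \<Delta>t =
       - (1 / (2 * sqrt (- (1/2) * (H m\<^sub>n \<bullet> m\<^sub>n)))) * (H m\<^sub>n \<bullet> ((m' - m\<^sub>n) /\<^sub>R \<Delta>t))"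

definition sav2_step ::
    "(real ^ 3) set \<Rightarrow> ('f :: euclidean_space \<Rightarrow> real ^ 3 \<Rightarrow> real) \<Rightarrow> ('f ^ 3 \<Rightarrow> 'f ^ 3)
      \<Rightarrow> ('f ^ 3 \<Rightarrow> 'f ^ 3) \<Rightarrow> real \<Rightarrow> real \<Rightarrow> real
      \<Rightarrow> 'f ^ 3 \<Rightarrow> real \<Rightarrow> 'f ^ 3 \<Rightarrow> real \<Rightarrow> 'f ^ 3 \<Rightarrow> real \<Rightarrow> bool" where
  "sav2_step N ev \<Delta>\<^sub>h H C\<^sub>e C\<^sub>a\<^sub>n \<Delta>t m\<^sub>n r\<^sub>n m\<^sub>s r\<^sub>s m' r' \<longleftrightarrow>
     sav_intermediate \<Delta>\<^sub>h C\<^sub>e C\<^sub>a\<^sub>n \<Delta>t (H m\<^sub>n) m\<^sub>n r\<^sub>n m\<^sub>s r\<^sub>s \<and>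
     is_normalization N ev m\<^sub>s m' \<and>
     r' = sqrt (- (1/2) * (H m' \<bullet> m'))"

definition modified_energy ::
    "('f :: euclidean_space ^ 3 \<Rightarrow> 'f ^ 3) \<Rightarrow> real \<Rightarrow> real \<Rightarrow> 'f ^ 3 \<Rightarrow> real \<Rightarrow> real" where
  "modified_energy \<Delta>\<^sub>h C\<^sub>e C\<^sub>a\<^sub>n m r =
     - (C\<^sub>e / 2) * (\<Delta>\<^sub>h m \<bullet> m) + C\<^sub>a\<^sub>n / 2 * ((norm (m $ 2))\<^sup>2 + (norm (m $ 3))\<^sup>2) + r\<^sup>2"

end

theory Submission
  imports Defs
begin

text \<open>
  Test the equation for \<open>m\<^sup>*\<close> with the increment \<open>d = m\<^sup>* - m\<^sup>n\<close>. The equation for \<open>r\<^sup>*\<close> is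
  designed so that the magnetostatic term, tested with \<open>d\<close>, becomes \<open>- 2 r\<^sup>* (r\<^sup>* - r\<^sup>n)\<close>, whatever
  the field is. This product, the exchange term and the anisotropy term each pair a symmetric
  operator, applied to the new state, with an increment, and polarization turns each into a
  difference of energies plus a quadratic form in the increment. Adding up gives the exact balance
  \<open>g(m\<^sup>*, r\<^sup>*) - g(m\<^sup>n, r\<^sup>n) =
      - \<parallel>d\<parallel>\<^sup>2 / \<Delta>t + C\<^sub>e / 2 (\<Delta>\<^sub>h d, d) - C\<^sub>a\<^sub>n / 2 (\<parallel>d\<^sub>2\<parallel>\<^sup>2 + \<parallel>d\<^sub>3\<parallel>\<^sup>2) - (r\<^sup>* - r\<^sup>n)\<^sup>2\<close>
  (\<open>sav_intermediate_energy_balance\<close>), in which every term on the right is nonpositive under the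
  sign condition on \<open>\<Delta>\<^sub>h\<close>. For the exchange term, the symmetry that polarization needs is the
  second condition, on the pair \<open>(m\<^sup>n, m\<^sup>*)\<close>.
\<close>

text \<open>
  The identity \<open>2 a (a - b) = a\<^sup>2 - b\<^sup>2 + (a - b)\<^sup>2\<close> for the form \<open>(A u, v)\<close>: expanding
  \<open>(A (u - v), u - v)\<close> produces both cross terms, which coincide by symmetry on the pair.
\<close>

lemma polarization_increment:
  fixes u v :: "'a :: real_inner"
  assumes "linear A" and "A v \<bullet> u = A u \<bullet> v"
  shows "2 * (A u \<bullet> (u - v)) = A u \<bullet> u - A v \<bullet> v + A (u - v) \<bullet> (u - v)"
  using assms by (simp add: linear_diff inner_diff_left inner_diff_right)

lemma polarization_increment_norm:
  fixes u v :: "'a :: real_inner"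
  shows "2 * (u \<bullet> (u - v)) = (norm u)\<^sup>2 - (norm v)\<^sup>2 + (norm (u - v))\<^sup>2"
  using polarization_increment[of "\<lambda>x. x" v u]
  by (simp add: power2_norm_eq_inner inner_commute linear_ident)

lemma inner_axis_left:
  fixes f :: "'a :: real_inner" and v :: "'a ^ 'n"
  shows "axis i f \<bullet> v = f \<bullet> v $ i"
  using inner_axis[of v i f] by (simp add: inner_commute)

text \<open>
  The equation for \<open>r\<^sup>*\<close> mimics the chain rule for \<open>r = sqrt (- (h, m) / 2)\<close> when \<open>h\<close> depends
  linearly and symmetrically on \<open>m\<close>, which gives \<open>\<partial>r = - (h, \<partial>m) / (2 r)\<close>. Hence the work of the
  field along the increment is controlled by \<open>r\<close> alone.
\<close>

lemma sav_intermediate_field_work: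
  assumes step: "sav_intermediate \<Delta>\<^sub>h C\<^sub>e C\<^sub>a\<^sub>n \<Delta>t h m\<^sub>n r\<^sub>n m\<^sub>s r\<^sub>s"
    and "\<Delta>t \<noteq> 0" and "h \<bullet> m\<^sub>n < 0"
  shows "r\<^sub>s / sqrt (- (1/2) * (h \<bullet> m\<^sub>n)) * (h \<bullet> (m\<^sub>s - m\<^sub>n)) = - 2 * r\<^sub>s * (r\<^sub>s - r\<^sub>n)"
proof -
  define s where "s = sqrt (- (1/2) * (h \<bullet> m\<^sub>n))"
  have "s \<noteq> 0"
    using assms(3) by (simp add: s_def)
  have "(r\<^sub>s - r\<^sub>n) / \<Delta>t = - (1 / (2 * s)) * (h \<bullet> ((m\<^sub>s - m\<^sub>n) /\<^sub>R \<Delta>t))"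
    using step unfolding sav_intermediate_def s_def by blast
  hence "(r\<^sub>s - r\<^sub>n) / \<Delta>t = (- (1 / (2 * s)) * (h \<bullet> (m\<^sub>s - m\<^sub>n))) / \<Delta>t"
    by (simp only: inner_scaleR_right divide_inverse ac_simps)
  hence "r\<^sub>s - r\<^sub>n = - (1 / (2 * s)) * (h \<bullet> (m\<^sub>s - m\<^sub>n))"
    using \<open>\<Delta>t \<noteq> 0\<close> unfolding divide_cancel_right by blast
  hence "h \<bullet> (m\<^sub>s - m\<^sub>n) = - 2 * s * (r\<^sub>s - r\<^sub>n)"
    using \<open>s \<noteq> 0\<close> by simp
  thus ?thesis
    using \<open>s \<noteq> 0\<close> unfolding s_def[symmetric] by simp
qed

text \<open>
  The first term on the right discretizes the dissipation of the gradient flow; the other three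
  are quadratic in the increments and come from evaluating the forces at the new state.
\<close>

lemma sav_intermediate_energy_balance:
  assumes step: "sav_intermediate \<Delta>\<^sub>h C\<^sub>e C\<^sub>a\<^sub>n \<Delta>t h m\<^sub>n r\<^sub>n m\<^sub>s r\<^sub>s"
    and "linear \<Delta>\<^sub>h" and "\<Delta>t \<noteq> 0" and "h \<bullet> m\<^sub>n < 0"
    and symmetric: "\<Delta>\<^sub>h m\<^sub>n \<bullet> m\<^sub>s = \<Delta>\<^sub>h m\<^sub>s \<bullet> m\<^sub>n"
  defines "d \<equiv> m\<^sub>s - m\<^sub>n"
  shows "modified_energy \<Delta>\<^sub>h C\<^sub>e C\<^sub>a\<^sub>n m\<^sub>s r\<^sub>s - modified_energy \<Delta>\<^sub>h C\<^sub>e C\<^sub>a\<^sub>n m\<^sub>n r\<^sub>n =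
    - ((norm d)\<^sup>2 / \<Delta>t) + C\<^sub>e / 2 * (\<Delta>\<^sub>h d \<bullet> d)
      - C\<^sub>a\<^sub>n / 2 * ((norm (d $ 2))\<^sup>2 + (norm (d $ 3))\<^sup>2) - (r\<^sub>s - r\<^sub>n)\<^sup>2"
proof -
  have "d /\<^sub>R \<Delta>t = C\<^sub>e *\<^sub>R \<Delta>\<^sub>h m\<^sub>s - C\<^sub>a\<^sub>n *\<^sub>R (axis 2 (m\<^sub>s $ 2) + axis 3 (m\<^sub>s $ 3))
      + (r\<^sub>s / sqrt (- (1/2) * (h \<bullet> m\<^sub>n))) *\<^sub>R h"
    using step unfolding sav_intermediate_def d_def by blast
  hence "(d /\<^sub>R \<Delta>t) \<bullet> d = (C\<^sub>e *\<^sub>R \<Delta>\<^sub>h m\<^sub>s - C\<^sub>a\<^sub>n *\<^sub>R (axis 2 (m\<^sub>s $ 2) + axis 3 (m\<^sub>s $ 3))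
      + (r\<^sub>s / sqrt (- (1/2) * (h \<bullet> m\<^sub>n))) *\<^sub>R h) \<bullet> d"
    by (rule arg_cong)
  hence "(norm d)\<^sup>2 / \<Delta>t = C\<^sub>e * (\<Delta>\<^sub>h m\<^sub>s \<bullet> d)
      - C\<^sub>a\<^sub>n * (m\<^sub>s $ 2 \<bullet> d $ 2 + m\<^sub>s $ 3 \<bullet> d $ 3)
      + r\<^sub>s / sqrt (- (1/2) * (h \<bullet> m\<^sub>n)) * (h \<bullet> d)"
    by (simp only: inner_add_left inner_diff_left inner_scaleR_left inner_axis_left
        power2_norm_eq_inner divide_inverse mult.commute)
  also have "r\<^sub>s / sqrt (- (1/2) * (h \<bullet> m\<^sub>n)) * (h \<bullet> d) = - 2 * r\<^sub>s * (r\<^sub>s - r\<^sub>n)"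
    unfolding d_def by (rule sav_intermediate_field_work[OF step assms(3,4)])
  finally have tested: "(norm d)\<^sup>2 / \<Delta>t = C\<^sub>e * (\<Delta>\<^sub>h m\<^sub>s \<bullet> d)
      - C\<^sub>a\<^sub>n * (m\<^sub>s $ 2 \<bullet> d $ 2 + m\<^sub>s $ 3 \<bullet> d $ 3) - 2 * r\<^sub>s * (r\<^sub>s - r\<^sub>n)"
    by simp
  have exchange: "\<Delta>\<^sub>h m\<^sub>s \<bullet> d = (\<Delta>\<^sub>h m\<^sub>s \<bullet> m\<^sub>s - \<Delta>\<^sub>h m\<^sub>n \<bullet> m\<^sub>n + \<Delta>\<^sub>h d \<bullet> d) / 2"
    using polarization_increment[OF assms(2) symmetric] unfolding d_def by simp
  have anisotropy: "m\<^sub>s $ i \<bullet> d $ i =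
      ((norm (m\<^sub>s $ i))\<^sup>2 - (norm (m\<^sub>n $ i))\<^sup>2 + (norm (d $ i))\<^sup>2) / 2" for i
    using polarization_increment_norm[of "m\<^sub>s $ i" "m\<^sub>n $ i"] unfolding d_def by simp
  show ?thesis
    unfolding modified_energy_def tested exchange anisotropy
    by (simp add: field_simps power2_eq_square)
qed

theorem theorem3p1:
  fixes \<Omega> N :: "(real ^ 3) set"
    and ev :: "'f :: euclidean_space \<Rightarrow> real ^ 3 \<Rightarrow> real"
    and \<Delta>\<^sub>h H :: "'f ^ 3 \<Rightarrow> 'f ^ 3"
    and C\<^sub>e\<^sub>x K\<^sub>u \<mu>\<^sub>0 M\<^sub>s C\<^sub>e C\<^sub>a\<^sub>n \<Delta>t :: real
    and m :: "nat \<Rightarrow> 'f ^ 3" and r :: "nat \<Rightarrow> real" and n :: nat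
    and m_star :: "'f ^ 3" and r_star :: real
  assumes "discrete_functions \<Omega> N ev"
    and "linear \<Delta>\<^sub>h"
    and "C\<^sub>e = 2 * C\<^sub>e\<^sub>x / (\<mu>\<^sub>0 * M\<^sub>s\<^sup>2)" and "C\<^sub>e > 0"
    and "C\<^sub>a\<^sub>n = 2 * K\<^sub>u / (\<mu>\<^sub>0 * M\<^sub>s\<^sup>2)" and "C\<^sub>a\<^sub>n > 0"
    and "\<Delta>t > 0"
    and "- (1/2) * (H (m n) \<bullet> m n) > 0"
    and "sav1_step N ev \<Delta>\<^sub>h H C\<^sub>e C\<^sub>a\<^sub>n \<Delta>t (m n) (r n) m_star r_star (m (Suc n)) (r (Suc n)) \<or>
         sav2_step N ev \<Delta>\<^sub>h H C\<^sub>e C\<^sub>a\<^sub>n \<Delta>t (m n) (r n) m_star r_star (m (Suc n)) (r (Suc n))"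
    and "\<Delta>\<^sub>h (m_star - m n) \<bullet> (m_star - m n) \<le> 0"
    and "\<Delta>\<^sub>h (m n) \<bullet> m_star - \<Delta>\<^sub>h m_star \<bullet> m n = 0"
  shows "modified_energy \<Delta>\<^sub>h C\<^sub>e C\<^sub>a\<^sub>n m_star r_star \<le> modified_energy \<Delta>\<^sub>h C\<^sub>e C\<^sub>a\<^sub>n (m n) (r n)"
proof -
  have step: "sav_intermediate \<Delta>\<^sub>h C\<^sub>e C\<^sub>a\<^sub>n \<Delta>t (H (m n)) (m n) (r n) m_star r_star"
    using assms(9) unfolding sav1_step_def sav2_step_def by blast
  define d where "d = m_star - m n"
  have "modified_energy \<Delta>\<^sub>h C\<^sub>e C\<^sub>a\<^sub>n m_star r_star - modified_energy \<Delta>\<^sub>h C\<^sub>e C\<^sub>a\<^sub>n (m n) (r n) =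
    - ((norm d)\<^sup>2 / \<Delta>t) + C\<^sub>e / 2 * (\<Delta>\<^sub>h d \<bullet> d)
      - C\<^sub>a\<^sub>n / 2 * ((norm (d $ 2))\<^sup>2 + (norm (d $ 3))\<^sup>2) - (r_star - r n)\<^sup>2"
    unfolding d_def
    by (rule sav_intermediate_energy_balance[OF step assms(2)])
      (use assms(7,8,11) in simp_all)
  moreover have "0 \<le> (norm d)\<^sup>2 / \<Delta>t"
    using \<open>\<Delta>t > 0\<close> by simp
  moreover have "C\<^sub>e / 2 * (\<Delta>\<^sub>h d \<bullet> d) \<le> 0"
    using \<open>C\<^sub>e > 0\<close> assms(10) unfolding d_def by (intro mult_nonneg_nonpos) simp_all
  moreover have "0 \<le> C\<^sub>a\<^sub>n / 2 * ((norm (d $ 2))\<^sup>2 + (norm (d $ 3))\<^sup>2)"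
    using \<open>C\<^sub>a\<^sub>n > 0\<close> by simp
  moreover have "0 \<le> (r_star - r n)\<^sup>2"
    by simp
  ultimately show ?thesis
    by linarith
qed

end
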